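(* Let $n\ge2$, let $\Omega\subset\mathbb{R}^n$ be an open set and let $f,g$ be positive continuous functions on $\Omega$ with $\int_\Omega f\,dx<\infty$. Let $1\le p\le q<\infty$, $\delta\in(0,1)$ and $\tau\in(0,\infty)$. Assume that for every ball $B\subset\subset\Omega$ there exists a constant $C=C(\Omega,B,f,g,p,q,\delta,\tau)$ such that \[ \Big(\int_A f(x)\,dx\Big)^{p/q}\le C\inf_u\int_\Omega g_u^\tau(x)g(x)\,dx \] for every admissible set $A\subset\Omega$ with $A\cap B=\emptyset$, where the infimum is over all $u\in C(\Omega)$ with $u|_A\ge1$ and $u|_B=0$. Then for every ball $B\subset\subset\Omega$ there is a constant $C$ such that for every $u\in C(\Omega)$ with $u|_B=0$, \[ \Big(\int_\Omega|u(x)|^qf(x)\,dx\Big)^{1/q}\le C\Big(\int_\Omega g_u^\tau(x)g(x)\,dx\Big)^{1/p}. \]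
   Context: $g_u^\tau(x)=\int_{\Omega\cap B(x,\tau d(x,\partial\Omega))}\frac{|u(x)-u(y)|^p}{|x-y|^{n+p\delta}}\,dy$ for $u\in C(\Omega)$. A set $A$ is an admissible subset of $\Omega$ if $A\subset\Omega$ is open and $\partial A\cap\Omega$ is a smooth submanifold. $B\subset\subset\Omega$ means $d(B,\partial\Omega)>0$. *)

theory Defs
  imports "HOL-Analysis.Analysis"
begin

fun iter_partial :: "'n::finite list \<Rightarrow> (real^'n \<Rightarrow> 'b::real_normed_vector) \<Rightarrow> real^'n \<Rightarrow> 'b" where
  "iter_partial [] F = F"
| "iter_partial (i # is) F =
     (\<lambda>x. frechet_derivative (iter_partial is F) (at x) (axis i 1))"

text \<open>C-infinity on an open set: every iterated partial derivative exists and is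
  (Frechet) differentiable on U (hence all of them are continuous).\<close>
definition smooth_on :: "(real^'n::finite) set \<Rightarrow> (real^'n \<Rightarrow> 'b::real_normed_vector) \<Rightarrow> bool" where
  "smooth_on U F \<longleftrightarrow> (\<forall>is. iter_partial is F differentiable_on U)"

definition smooth_submanifold :: "(real^'n::finite) set \<Rightarrow> bool" where
  "smooth_submanifold M \<longleftrightarrow>
     (\<forall>p\<in>M. \<exists>U V L (\<phi>::real^'n \<Rightarrow> real^'n) \<psi>. open U \<and> p \<in> U \<and> open V \<and> subspace L \<and>
        smooth_on U \<phi> \<and> smooth_on V \<psi> \<and> \<phi> ` U = V \<and>
        (\<forall>x\<in>U. \<psi> (\<phi> x) = x) \<and> (\<forall>y\<in>V. \<phi> (\<psi> y) = y) \<and>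
        \<phi> ` (M \<inter> U) = V \<inter> L)"

definition admissible :: "(real^'n::finite) set \<Rightarrow> (real^'n) set \<Rightarrow> bool" where
  "admissible \<Omega> A \<longleftrightarrow> A \<subseteq> \<Omega> \<and> open A \<and> smooth_submanifold (frontier A \<inter> \<Omega>)"

text \<open>B compactly contained: B \<subseteq> \<Omega> and d(B, boundary of \<Omega>) > 0
  (with d(B, empty set) = +infinity).\<close>
definition compactly_in :: "(real^'n::finite) set \<Rightarrow> (real^'n) set \<Rightarrow> bool" where
  "compactly_in B \<Omega> \<longleftrightarrow> B \<subseteq> \<Omega> \<and> (frontier \<Omega> = {} \<or> setdist B (frontier \<Omega>) > 0)"

text \<open>The set \<Omega> \<inter> B(x, \<tau> d(x, boundary of \<Omega>)), with d(x, empty set) = +infinity.\<close>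
definition nbhd_region :: "(real^'n::finite) set \<Rightarrow> real \<Rightarrow> real^'n \<Rightarrow> (real^'n) set" where
  "nbhd_region \<Omega> \<tau> x =
     \<Omega> \<inter> (if frontier \<Omega> = {} then UNIV else ball x (\<tau> * infdist x (frontier \<Omega>)))"

definition gu :: "(real^'n::finite) set \<Rightarrow> real \<Rightarrow> real \<Rightarrow> real \<Rightarrow> (real^'n \<Rightarrow> real) \<Rightarrow> real^'n \<Rightarrow> ennreal" where
  "gu \<Omega> p \<delta> \<tau> u x =
     (\<integral>\<^sup>+ y \<in> nbhd_region \<Omega> \<tau> x.
        ennreal (\<bar>u x - u y\<bar> powr p / norm (x - y) powr (real CARD('n) + p * \<delta>)) \<partial>lebesgue)"

text \<open>Real power of an extended nonnegative real (exponent > 0), with \<infinity>^a = \<infinity>.\<close>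
definition ennpow :: "ennreal \<Rightarrow> real \<Rightarrow> ennreal" where
  "ennpow x a = (if x = \<infinity> then \<infinity> else ennreal (enn2real x powr a))"

end

theory Submission
  imports Defs
begin

text \<open>
  Maz'ya's truncation argument. For dyadic levels \<open>l\<^sub>j\<close> the normalised layers
  \<open>w\<^sub>j = (min \<bar>u\<bar> l\<^sub>j\<^sub>+\<^sub>1 - min \<bar>u\<bar> l\<^sub>j) / l\<^sub>j\<close> are test functions for the level sets
  \<open>{\<bar>u\<bar> > l\<^sub>j\<^sub>+\<^sub>1}\<close>. The layers of a function add up without cancellation, so
  \<open>\<Sum>\<^sub>j l\<^sub>j\<^sup>p \<bar>w\<^sub>j x - w\<^sub>j y\<bar>\<^sup>p \<le> \<bar>u x - u y\<bar>\<^sup>p\<close> holds pointwise and the nonlocal energies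
  of the layers sum to at most the energy of \<open>u\<close>.

  A level set need not be admissible, and no appeal to Sard's theorem is made: by Vitali's
  covering theorem every open set is, up to a null set, the increasing union of finite unions
  of balls with pairwise disjoint closures, and these have smooth boundary.
\<close>

section \<open>Smoothness of inversions\<close>

text \<open>Iterated partials use \<open>frechet_derivative\<close>, which carries information only
  where the function is differentiable, so they can be matched with members of \<open>K\<close> on
  \<open>U\<close> alone. Openness of \<open>U\<close> lets this agreement pass to the next
  derivative.\<close>

lemma smooth_on_closed_class:
  fixes U :: "(real^'n::finite) set"
  assumes "open U" "F \<in> K"
    and D: "\<And>F x. F \<in> K \<Longrightarrow> x \<in> U \<Longrightarrow> F differentiable at x"
    and P: "\<And>F i. F \<in> K \<Longrightarrow> \<exists>G\<in>K. \<forall>x\<in>U. frechet_derivative F (at x) (axis i 1) = G x"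
  shows "smooth_on U F"
proof -
  have "\<exists>G\<in>K. \<forall>x\<in>U. iter_partial is F x = G x" for "is"
  proof (induction "is")
    case Nil
    then show ?case using assms by auto
  next
    case (Cons i "is")
    then obtain G where G: "G \<in> K" "\<forall>x\<in>U. iter_partial is F x = G x" by auto
    from P[OF G(1)] obtain H where H: "H\<in>K" "\<forall>x\<in>U. frechet_derivative G (at x) (axis i 1) = H x"
      by blast
    have "frechet_derivative (iter_partial is F) (at x) = frechet_derivative G (at x)" if "x \<in> U" for x
      by (rule frechet_derivative_transform_within_open[OF D[OF G(1) that] \<open>open U\<close> that, symmetric])
        (use G(2) in auto)
    then show ?case using H by auto
  qed
  moreover have "iter_partial is F differentiable at x"
    if "x \<in> U" "G\<in>K" "\<forall>x\<in>U. iter_partial is F x = G x" for G x "is"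
    using D[OF that(2,1)] that \<open>open U\<close> unfolding differentiable_def
    by (metis has_derivative_transform_within_open)
  ultimately show ?thesis
    unfolding smooth_on_def differentiable_on_def
    by (meson differentiable_at_withinI)
qed

text \<open>An algebra of functions made to contain the components of the inversion centred at
  \<open>a\<close> and to be stable under partial derivatives away from \<open>a\<close>.\<close>

inductive_set rational_class :: "real^'n::finite \<Rightarrow> (real^'n \<Rightarrow> real) set" for a where
  const: "(\<lambda>x. c) \<in> rational_class a"
| coord: "(\<lambda>x. x $ i) \<in> rational_class a"
| inv: "(\<lambda>x. inverse ((x - a) \<bullet> (x - a))) \<in> rational_class a"
| add: "f \<in> rational_class a \<Longrightarrow> g \<in> rational_class a \<Longrightarrow> (\<lambda>x. f x + g x) \<in> rational_class a"
| mult: "f \<in> rational_class a \<Longrightarrow> g \<in> rational_class a \<Longrightarrow> (\<lambda>x. f x * g x) \<in> rational_class a"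

lemma rational_class_deriv:
  fixes a :: "real^'n::finite"
  assumes "f \<in> rational_class a"
  shows "\<exists>f'. (\<forall>x. x \<noteq> a \<longrightarrow> (f has_derivative f' x) (at x)) \<and>
              (\<forall>i. (\<lambda>x. f' x (axis i 1)) \<in> rational_class a)"
  using assms
proof induction
  case (const c)
  then show ?case
    by (intro exI[of _ "\<lambda>x h. 0"] conjI allI impI has_derivative_const rational_class.const)
next
  case (coord j)
  have "(\<lambda>x. axis i 1 $ j) \<in> rational_class a" for i by (rule rational_class.const)
  then show ?case
    by (intro exI[of _ "\<lambda>x h. h $ j"] conjI allI impI)
      (simp_all add: bounded_linear_imp_has_derivative bounded_linear_vec_nth)
next
  case inv
  \<comment> \<open>The derivative of \<open>1 / |x - a|^2\<close> is kept as a product of two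
    inverses and a linear factor, so that its partials are visibly in the class again.\<close>
  let ?f' = "\<lambda>x h. - (inverse ((x - a) \<bullet> (x - a)) * (2 * ((x - a) \<bullet> h)) * inverse ((x - a) \<bullet> (x - a)))"
  have "((\<lambda>x. inverse ((x - a) \<bullet> (x - a))) has_derivative ?f' x) (at x)" if "x \<noteq> a" for x
    using that by (auto intro!: derivative_eq_intros simp: inner_commute)
  moreover have "(\<lambda>x. ?f' x (axis i 1)) \<in> rational_class a" for i
  proof -
    have "(\<lambda>x. inverse ((x - a) \<bullet> (x - a)) * ((-2) * (x $ i + - (a $ i))) * inverse ((x - a) \<bullet> (x - a))) \<in> rational_class a"
      by (intro rational_class.intros)
    moreover have "(\<lambda>x. ?f' x (axis i 1)) = (\<lambda>x. inverse ((x - a) \<bullet> (x - a)) * ((-2) * (x $ i + - (a $ i))) * inverse ((x - a) \<bullet> (x - a)))"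
      by (auto simp: inner_axis algebra_simps)
    ultimately show ?thesis by simp
  qed
  ultimately show ?case by (intro exI[of _ ?f']) blast
next
  case (add f g)
  then obtain f' g' where *: "\<forall>x. x \<noteq> a \<longrightarrow> (f has_derivative f' x) (at x)" "\<forall>i. (\<lambda>x. f' x (axis i 1)) \<in> rational_class a"
   "\<forall>x. x \<noteq> a \<longrightarrow> (g has_derivative g' x) (at x)" "\<forall>i. (\<lambda>x. g' x (axis i 1)) \<in> rational_class a" by blast
  then show ?case
    by (intro exI[of _ "\<lambda>x h. f' x h + g' x h"] conjI allI impI rational_class.add has_derivative_add) blast+
next
  case (mult f g)
  then obtain f' g' where *: "\<forall>x. x \<noteq> a \<longrightarrow> (f has_derivative f' x) (at x)" "\<forall>i. (\<lambda>x. f' x (axis i 1)) \<in> rational_class a"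
   "\<forall>x. x \<noteq> a \<longrightarrow> (g has_derivative g' x) (at x)" "\<forall>i. (\<lambda>x. g' x (axis i 1)) \<in> rational_class a" by blast
  then show ?case using mult.hyps
    by (intro exI[of _ "\<lambda>x h. f x * g' x h + f' x h * g x"] conjI allI impI
          rational_class.add rational_class.mult has_derivative_mult) blast+
qed

text \<open>Vector fields whose components all lie in \<open>rational_class a\<close> form a family
  closed under partial derivatives off \<open>a\<close>, because derivatives are taken
  componentwise.\<close>

lemma smooth_on_rational:
  fixes a :: "real^'n::finite"
  assumes U: "open U" "a \<notin> U" and F: "\<And>j. (\<lambda>x. F x $ j) \<in> rational_class a"
  shows "smooth_on U (F :: real^'n \<Rightarrow> real^'m)"
proof -
  let ?K = "{F :: real^'n \<Rightarrow> real^'m. \<forall>j. (\<lambda>x. F x $ j) \<in> rational_class a}"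
  have *: "\<exists>F'. (\<forall>x\<in>U. (F has_derivative F' x) (at x)) \<and> (\<forall>i. (\<lambda>x. F' x (axis i 1)) \<in> ?K)"
    if "F \<in> ?K" for F
  proof -
    have "\<forall>j. \<exists>f'. (\<forall>x. x \<noteq> a \<longrightarrow> ((\<lambda>x. F x $ j) has_derivative f' x) (at x)) \<and>
              (\<forall>i. (\<lambda>x. f' x (axis i 1)) \<in> rational_class a)"
      using that rational_class_deriv by blast
    then obtain f' where f': "\<And>j x. x \<noteq> a \<Longrightarrow> ((\<lambda>x. F x $ j) has_derivative f' j x) (at x)"
      "\<And>j i. (\<lambda>x. f' j x (axis i 1)) \<in> rational_class a" by metis
    have "(F has_derivative (\<lambda>h. \<chi> j. f' j x h)) (at x)" if "x \<in> U" for x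
    proof -
      have "((\<lambda>x. \<chi> j. F x $ j) has_derivative (\<lambda>h. \<chi> j. f' j x h)) (at x)"
        using f'(1)[of x] that U(2) 
        by (subst has_derivative_componentwise_within) (force simp: Basis_vec_def inner_axis)
      then show ?thesis by simp
    qed
    then show ?thesis using f'(2)
      by (intro exI[of _ "\<lambda>x h. \<chi> j. f' j x h"]) auto
  qed
  show ?thesis
  proof (rule smooth_on_closed_class[where K = ?K])
    fix F x assume "F \<in> ?K" "x \<in> U"
    then show "F differentiable at x" using * unfolding differentiable_def by blast
  next
    fix F i assume "F \<in> ?K"
    from *[OF this] obtain F' where F': "\<forall>x\<in>U. (F has_derivative F' x) (at x)" "\<forall>i. (\<lambda>x. F' x (axis i 1)) \<in> ?K" by blast
    then have "\<forall>x\<in>U. frechet_derivative F (at x) (axis i 1) = F' x (axis i 1)"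
      using frechet_derivative_at by metis
    then show "\<exists>G\<in>?K. \<forall>x\<in>U. frechet_derivative F (at x) (axis i 1) = G x"
      using F'(2) by (intro bexI[of _ "\<lambda>x. F' x (axis i 1)"]) auto
  qed (use U F in auto)
qed

text \<open>Exchanging \<open>a\<close> and \<open>b\<close> turns the map into its inverse, so one
  statement covers a chart and its inverse.\<close>

lemma smooth_on_inversion:
  fixes a b :: "real^'n::finite"
  shows "smooth_on (- {a}) (\<lambda>x. b + inverse ((x - a) \<bullet> (x - a)) *\<^sub>R (x - a))"
proof (rule smooth_on_rational[of _ a])
  fix j
  have "(\<lambda>x. b $ j + inverse ((x - a) \<bullet> (x - a)) * (x $ j + - (a $ j))) \<in> rational_class a"
    by (intro rational_class.intros)
  then show "(\<lambda>x. (b + inverse ((x - a) \<bullet> (x - a)) *\<^sub>R (x - a)) $ j) \<in> rational_class a"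
    by simp
qed auto

section \<open>Spheres are smooth submanifolds\<close>

text \<open>The two scalings cancel, since
  \<open>\<zeta> \<bullet> \<zeta> = inverse (z \<bullet> z)\<close>.\<close>

lemma inversion_involutive:
  fixes z :: "'a::real_inner"
  assumes "z \<noteq> 0" "\<zeta> = inverse (z \<bullet> z) *\<^sub>R z"
  shows "inverse (\<zeta> \<bullet> \<zeta>) *\<^sub>R \<zeta> = z" "\<zeta> \<noteq> 0"
  using assms by (auto simp: field_simps)

text \<open>The chart at \<open>p\<close> is the inversion centred at the antipode of \<open>p\<close>, which flattens the
  sphere to a hyperplane.\<close>

lemma smooth_submanifold_sphere:
  fixes c :: "real^'n::finite"
  assumes "0 < r"
  shows "smooth_submanifold (sphere c r)"
  unfolding smooth_submanifold_def
proof
  fix p assume "p \<in> sphere c r"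
  define w where "w = p - c"
  define a where "a = c - w"
  \<comment> \<open>This translation has \<open>w \<bullet> b = - 1 / 2\<close>; it moves the image
    hyperplane through the origin, as \<open>L\<close> must be a linear subspace.\<close>
  define b where "b = - (inverse (2 * (w \<bullet> w)) *\<^sub>R w)"
  define \<phi> where "\<phi> = (\<lambda>x. b + inverse ((x - a) \<bullet> (x - a)) *\<^sub>R (x - a))"
  define \<psi> where "\<psi> = (\<lambda>x. a + inverse ((x - b) \<bullet> (x - b)) *\<^sub>R (x - b))"
  define L where "L = {y. w \<bullet> y = 0}"
  have w: "norm w = r" using \<open>p \<in> _\<close> by (simp add: w_def dist_norm norm_minus_commute)
  then have ww: "w \<bullet> w > 0" using assms by auto
  have "p - a = 2 *\<^sub>R w" by (simp add: a_def w_def scaleR_2)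
  moreover have "w \<noteq> 0" using ww by auto
  ultimately have pa: "p \<noteq> a" by auto
  have i1: "\<phi> x \<noteq> b \<and> \<psi> (\<phi> x) = x" if "x \<noteq> a" for x
    using inversion_involutive[of "x - a" "\<phi> x - b"] that by (auto simp: \<phi>_def \<psi>_def)
  have i2: "\<psi> x \<noteq> a \<and> \<phi> (\<psi> x) = x" if "x \<noteq> b" for x
    using inversion_involutive[of "x - b" "\<psi> x - a"] that by (auto simp: \<phi>_def \<psi>_def)
  have S: "x \<in> sphere c r \<longleftrightarrow> \<phi> x \<in> L" if "x \<noteq> a" for x
  proof -
    let ?z = "x - a"
    have zz: "?z \<bullet> ?z > 0" using that by simp
    \<comment> \<open>Seen from the antipode, \<open>x - c = ?z - w\<close>, so the equation of the
      sphere has no constant term. Dividing it by \<open>?z \<bullet> ?z\<close> makes it linear in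
      \<open>\<phi> x\<close>.\<close>
    have "x \<in> sphere c r \<longleftrightarrow> (norm (?z - w))\<^sup>2 = (norm w)\<^sup>2"
      using assms unfolding w by (auto simp: a_def dist_norm norm_minus_commute)
    also have "\<dots> \<longleftrightarrow> ?z \<bullet> ?z = 2 * (w \<bullet> ?z)"
      unfolding power2_norm_eq_inner inner_diff_left[of ?z w] inner_diff_right[of _ ?z w]
      by (simp add: inner_commute[of ?z w])
    also have "\<dots> \<longleftrightarrow> w \<bullet> \<phi> x = 0"
    proof -
      have "w \<bullet> \<phi> x = inverse (?z \<bullet> ?z) * (w \<bullet> ?z) - 1 / 2"
        using ww unfolding \<phi>_def b_def inner_add_right inner_minus_right inner_scaleR_right
        by simp
      then show ?thesis using zz by (auto simp: divide_simps)
    qed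
    finally show ?thesis by (simp add: L_def)
  qed
  show "\<exists>U V L (\<phi>::real^'n \<Rightarrow> real^'n) \<psi>. open U \<and> p \<in> U \<and> open V \<and> subspace L \<and>
        smooth_on U \<phi> \<and> smooth_on V \<psi> \<and> \<phi> ` U = V \<and>
        (\<forall>x\<in>U. \<psi> (\<phi> x) = x) \<and> (\<forall>y\<in>V. \<phi> (\<psi> y) = y) \<and>
        \<phi> ` (sphere c r \<inter> U) = V \<inter> L"
  proof (intro exI conjI)
    show "smooth_on (- {a}) \<phi>" "smooth_on (-{b}) \<psi>"
      unfolding \<phi>_def \<psi>_def by (rule smooth_on_inversion)+
    show "subspace L" unfolding L_def by (rule subspace_hyperplane)
    show "\<phi> ` (- {a}) = - {b}" using i1 i2 by force
    show "\<phi> ` (sphere c r \<inter> - {a}) = - {b} \<inter> L" 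
    proof (intro equalityI subsetI)
      fix y assume "y \<in> - {b} \<inter> L"
      then show "y \<in> \<phi> ` (sphere c r \<inter> - {a})"
        using i2[of y] S[of "\<psi> y"] by (intro image_eqI[of _ _ "\<psi> y"]) auto
    qed (use S i1 in auto)
  qed (use i1 i2 pa in auto)
qed

section \<open>Admissibility of finite unions of balls\<close>

lemma smooth_on_subset: "smooth_on U F \<Longrightarrow> T \<subseteq> U \<Longrightarrow> smooth_on T F"
  unfolding smooth_on_def using differentiable_on_subset by blast

lemma smooth_on_imp_continuous_on: "smooth_on U F \<Longrightarrow> continuous_on U F"
  unfolding smooth_on_def using differentiable_imp_continuous_on iter_partial.simps(1) by metis

text \<open>A chart of \<open>N\<close> at \<open>p\<close> restricts to a chart of \<open>M\<close>
  on a smaller neighbourhood. The model \<open>N\<close> may change with \<open>p\<close>, which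
  allows a different sphere near each boundary point.\<close>

lemma smooth_submanifold_local:
  assumes "\<And>p. p \<in> M \<Longrightarrow> \<exists>W N. open W \<and> p \<in> W \<and> smooth_submanifold N \<and> M \<inter> W = N \<inter> W"
  shows "smooth_submanifold M"
  unfolding smooth_submanifold_def
proof
  fix p assume "p \<in> M"
  with assms obtain W N where W: "open W" "p \<in> W" "smooth_submanifold N" "M \<inter> W = N \<inter> W" by blast
  then have "p \<in> N" using \<open>p \<in> M\<close> by blast
  then obtain U V L and \<phi> :: "real^'a \<Rightarrow> real^'a" and \<psi> where *: "open U" "p \<in> U" "open V" "subspace L"
        "smooth_on U \<phi>" "smooth_on V \<psi>" "\<phi> ` U = V"
        "\<forall>x\<in>U. \<psi> (\<phi> x) = x" "\<forall>y\<in>V. \<phi> (\<psi> y) = y" "\<phi> ` (N \<inter> U) = V \<inter> L"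
    using W(3)[unfolded smooth_submanifold_def, rule_format, OF \<open>p \<in> N\<close>]
    by (elim exE conjE) (rule that)
  \<comment> \<open>The image of \<open>U \<inter> W\<close> under \<open>\<phi>\<close>, written as
    a preimage under \<open>\<psi>\<close> so that continuity of \<open>\<psi>\<close> makes it
    open.\<close>
  define V' where "V' = V \<inter> \<psi> -` (U \<inter> W)"
  have im: "\<phi> ` (U \<inter> W) = V'"
  proof (intro equalityI subsetI)
    fix y assume "y \<in> V'"
    then show "y \<in> \<phi> ` (U \<inter> W)"
      unfolding V'_def using *(9) by (intro image_eqI[of _ _ "\<psi> y"]) auto
  next
    fix y assume "y \<in> \<phi> ` (U \<inter> W)"
    then show "y \<in> V'" unfolding V'_def using *(7,8) by auto
  qed
  show "\<exists>U V L (\<phi>::real^'a \<Rightarrow> real^'a) \<psi>. open U \<and> p \<in> U \<and> open V \<and> subspace L \<and>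
        smooth_on U \<phi> \<and> smooth_on V \<psi> \<and> \<phi> ` U = V \<and>
        (\<forall>x\<in>U. \<psi> (\<phi> x) = x) \<and> (\<forall>y\<in>V. \<phi> (\<psi> y) = y) \<and>
        \<phi> ` (M \<inter> U) = V \<inter> L"
  proof (intro exI conjI)
    show "open (U \<inter> W)" using * W by auto
    show "open V'" unfolding V'_def
      by (rule continuous_open_preimage) (use * W smooth_on_imp_continuous_on in auto)
    show "smooth_on (U \<inter> W) \<phi>" "smooth_on V' \<psi>"
      using *(5,6) by (auto simp: V'_def intro: smooth_on_subset)
    show "\<phi> ` (M \<inter> (U \<inter> W)) = V' \<inter> L"
    proof -
      have "M \<inter> (U \<inter> W) = (N \<inter> U) \<inter> (U \<inter> W)" using W by blast
      also have "\<phi> ` \<dots> = \<phi> ` (N \<inter> U) \<inter> \<phi> ` (U \<inter> W)"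
        by (rule inj_on_image_Int[of \<phi> U]) (use *(8) in \<open>auto intro: inj_on_inverseI\<close>)
      also have "\<dots> = V' \<inter> L" using im *(10) unfolding V'_def by auto
      finally show ?thesis .
    qed
    show "p \<in> U \<inter> W" using *(2) W(2) by blast
    show "subspace L" by fact
    show "\<phi> ` (U \<inter> W) = V'" by fact
    show "\<forall>x\<in>U \<inter> W. \<psi> (\<phi> x) = x" using *(8) by blast
    show "\<forall>y\<in>V'. \<phi> (\<psi> y) = y" using *(9) unfolding V'_def by blast
  qed
qed

text \<open>As the closed balls are disjoint, a boundary point lies on exactly one sphere. As they
  are finitely many, the union of the others is closed and can be removed to leave a neighbourhood
  that meets only this sphere.\<close>

lemma admissible_disjoint_balls:
  fixes \<Omega> :: "(real^'n::finite) set"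
  assumes "open \<Omega>" "finite I" and r: "\<And>i. i \<in> I \<Longrightarrow> 0 < r i"
    and sub: "\<And>i. i \<in> I \<Longrightarrow> ball (a i) (r i) \<subseteq> \<Omega>"
    and dis: "pairwise (\<lambda>i j. disjnt (cball (a i) (r i)) (cball (a j) (r j))) I"
  shows "admissible \<Omega> (\<Union>i\<in>I. ball (a i) (r i))"
proof -
  let ?A = "\<Union>i\<in>I. ball (a i) (r i)"
  have "smooth_submanifold (frontier ?A \<inter> \<Omega>)"
  proof (rule smooth_submanifold_local)
    fix p assume p: "p \<in> frontier ?A \<inter> \<Omega>"
    have op: "open ?A" by auto
    have cl: "closure ?A = (\<Union>i\<in>I. cball (a i) (r i))"
    proof
      show "closure ?A \<subseteq> (\<Union>i\<in>I. cball (a i) (r i))"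
        by (intro closure_minimal closed_UN UN_mono \<open>finite I\<close>) auto
      show "(\<Union>i\<in>I. cball (a i) (r i)) \<subseteq> closure ?A"
      proof (rule UN_least)
        fix i assume i: "i \<in> I"
        then have "cball (a i) (r i) = closure (ball (a i) (r i))" using r[OF i] by simp
        also have "\<dots> \<subseteq> closure ?A" using i by (intro closure_mono) blast
        finally show "cball (a i) (r i) \<subseteq> closure ?A" .
      qed
    qed
    have fr: "frontier ?A = (\<Union>i\<in>I. cball (a i) (r i)) - ?A"
      unfolding frontier_def cl interior_open[OF op] ..
    obtain i where i: "i \<in> I" "p \<in> cball (a i) (r i)" "p \<notin> ?A" "p \<in> \<Omega>"
      using p unfolding fr by blast
    define R where "R = (\<Union>j\<in>I-{i}. cball (a j) (r j))"
    have "closed R" unfolding R_def using \<open>finite I\<close> by auto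
    have d: "cball (a i) (r i) \<inter> R = {}"
      unfolding R_def using dis i(1) unfolding pairwise_def disjnt_def by blast
    have "(frontier ?A \<inter> \<Omega>) \<inter> (\<Omega> - R) = sphere (a i) (r i) \<inter> (\<Omega> - R)"
    proof -
      have 1: "(\<Union>j\<in>I. cball (a j) (r j)) = cball (a i) (r i) \<union> R"
        unfolding R_def using i(1) by auto
      have 2: "?A - R = ball (a i) (r i) - R"
        unfolding R_def using i(1) ball_subset_cball by blast
      have 3: "sphere (a i) (r i) = cball (a i) (r i) - ball (a i) (r i)" by auto
      show ?thesis unfolding fr 1 3 using 2 by blast
    qed
    moreover have "open (\<Omega> - R)" using \<open>open \<Omega>\<close> \<open>closed R\<close> by auto
    moreover have "p \<in> \<Omega> - R" using i d by auto
    ultimately show "\<exists>W N. open W \<and> p \<in> W \<and> smooth_submanifold N \<and> (frontier ?A \<inter> \<Omega>) \<inter> W = N \<inter> W"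
      using smooth_submanifold_sphere[OF r[OF i(1)]] by blast
  qed
  then show ?thesis using sub unfolding admissible_def by auto
qed

section \<open>Superadditivity of the integral\<close>

text \<open>The lower integral is superadditive for arbitrary functions; this spares a proof that
  \<open>gu \<Omega> p \<delta> \<tau> u\<close> is measurable.\<close>

lemma nn_integral_add_ge:
  "(\<integral>\<^sup>+ x. f x \<partial>M) + (\<integral>\<^sup>+ x. g x \<partial>M) \<le> (\<integral>\<^sup>+ x. f x + g x \<partial>M)"
proof -
  let ?S = "\<lambda>f :: _ \<Rightarrow> ennreal. {s. simple_function M s \<and> s \<le> f}"
  have "integral\<^sup>S M s + integral\<^sup>S M t \<le> (\<integral>\<^sup>+ x. f x + g x \<partial>M)" if "s \<in> ?S f" "t \<in> ?S g" for s t
  proof -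
    have "integral\<^sup>S M s + integral\<^sup>S M t = (\<integral>\<^sup>S x. s x + t x \<partial>M)"
      using that by simp
    also have "\<dots> = (\<integral>\<^sup>+ x. s x + t x \<partial>M)"
      using that by (simp add: nn_integral_eq_simple_integral)
    also have "\<dots> \<le> (\<integral>\<^sup>+ x. f x + g x \<partial>M)"
      using that by (intro nn_integral_mono add_mono) (auto simp: le_fun_def)
    finally show ?thesis .
  qed
  \<comment> \<open>The zero function makes both index sets nonempty, as is required for moving an
    addition inside a supremum.\<close>
  moreover have "(\<lambda>x. 0) \<in> ?S h" for h by (auto simp: le_fun_def)
  then have "?S f \<noteq> {}" "?S g \<noteq> {}" by blast+
  ultimately show ?thesis
    unfolding nn_integral_def[of M f] nn_integral_def[of M g]
    by (subst ennreal_SUP_add_left[symmetric], blast,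
        intro SUP_least, subst ennreal_SUP_add_right, blast, intro SUP_least) auto
qed

lemma nn_integral_cmult_ge:
  "c * (\<integral>\<^sup>+ x. f x \<partial>M) \<le> (\<integral>\<^sup>+ x. c * f x \<partial>M)"
proof -
  have "c * integral\<^sup>S M s \<le> (\<integral>\<^sup>+ x. c * f x \<partial>M)" if "simple_function M s" "s \<le> f" for s
  proof -
    have "c * integral\<^sup>S M s = (\<integral>\<^sup>+ x. c * s x \<partial>M)"
      using that by (simp add: nn_integral_eq_simple_integral flip: nn_integral_cmult)
    also have "\<dots> \<le> (\<integral>\<^sup>+ x. c * f x \<partial>M)"
      using that by (intro nn_integral_mono mult_left_mono) (auto simp: le_fun_def)
    finally show ?thesis .
  qed
  then show ?thesis
    unfolding nn_integral_def[of M f] by (auto simp: SUP_mult_left_ennreal intro!: SUP_least)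
qed

text \<open>Serves twice in comparing energies: for the inner integral over \<open>y\<close> that
  defines \<open>gu\<close>, and for the outer integral over \<open>x\<close>.\<close>

lemma nn_integral_sum_cmult_ge:
  assumes "finite J"
  shows "(\<Sum>j\<in>J. c j * (\<integral>\<^sup>+ x. F j x \<partial>M)) \<le> (\<integral>\<^sup>+ x. (\<Sum>j\<in>J. c j * F j x) \<partial>M)"
  using assms
proof (induction J rule: finite_induct)
  case (insert j J)
  have "(\<Sum>j\<in>insert j J. c j * (\<integral>\<^sup>+ x. F j x \<partial>M))
      \<le> (\<integral>\<^sup>+ x. c j * F j x \<partial>M) + (\<integral>\<^sup>+ x. (\<Sum>j\<in>J. c j * F j x) \<partial>M)"
    using insert by (simp add: add_mono nn_integral_cmult_ge)
  also have "\<dots> \<le> (\<integral>\<^sup>+ x. c j * F j x + (\<Sum>j\<in>J. c j * F j x) \<partial>M)"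
    by (rule nn_integral_add_ge)
  finally show ?case using insert by simp
qed simp

section \<open>Inequalities for powers and layers\<close>

text \<open>For \<open>t\<close> equal to \<open>a\<close> or \<open>b\<close>, writing
  \<open>t powr s\<close> as \<open>t\<close> times \<open>t powr (s - 1)\<close> and enlarging the
  second factor to \<open>(a + b) powr (s - 1)\<close> gives two bounds whose sum is the
  claim.\<close>

lemma powr_superadditive:
  fixes a b s :: real
  assumes "0 \<le> a" "0 \<le> b" "1 \<le> s"
  shows "a powr s + b powr s \<le> (a + b) powr s"
proof (cases "a + b = 0")
  case False
  then have pos: "a + b > 0" using assms by linarith
  have *: "t powr s \<le> t * (a + b) powr (s - 1)" if "0 \<le> t" "t \<le> a + b" for t
  proof (cases "t = 0")
    case False
    then have "t powr s = t * t powr (s - 1)" using that by (simp add: powr_diff)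
    also have "\<dots> \<le> t * (a + b) powr (s - 1)"
      using that assms by (intro mult_left_mono powr_mono2) auto
    finally show ?thesis .
  qed simp
  have "a powr s + b powr s \<le> (a + b) * (a + b) powr (s - 1)"
    using *[of a] *[of b] assms by (simp add: distrib_right)
  also have "\<dots> = (a + b) powr s" using pos by (simp add: powr_diff)
  finally show ?thesis .
next
  case True
  then have "a = 0" "b = 0" using assms by linarith+
  then show ?thesis by simp
qed

lemma sum_powr_le_powr_sum:
  fixes a :: "'i \<Rightarrow> real"
  assumes "finite J" "\<And>j. j \<in> J \<Longrightarrow> 0 \<le> a j" "1 \<le> s"
  shows "(\<Sum>j\<in>J. a j powr s) \<le> (\<Sum>j\<in>J. a j) powr s"
  using assms
proof (induction J rule: finite_induct)
  case (insert j J)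
  have "a j powr s + (\<Sum>j\<in>J. a j powr s) \<le> a j powr s + (\<Sum>j\<in>J. a j) powr s"
    using insert by auto
  also have "\<dots> \<le> (a j + (\<Sum>j\<in>J. a j)) powr s"
    using insert by (intro powr_superadditive sum_nonneg) auto
  finally show ?case using insert by simp
qed simp

text \<open>The superadditive inequality with exponent \<open>1 / s \<ge> 1\<close>, applied to the
  numbers \<open>a j powr s\<close>.\<close>

lemma powr_sum_le_sum_powr:
  fixes a :: "'i \<Rightarrow> real"
  assumes "finite J" "\<And>j. j \<in> J \<Longrightarrow> 0 \<le> a j" "0 < s" "s \<le> 1"
  shows "(\<Sum>j\<in>J. a j) powr s \<le> (\<Sum>j\<in>J. a j powr s)"
proof -
  have "(\<Sum>j\<in>J. a j) = (\<Sum>j\<in>J. (a j powr s) powr (1 / s))"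
    using assms by (intro sum.cong) (auto simp: powr_powr)
  also have "\<dots> \<le> (\<Sum>j\<in>J. a j powr s) powr (1 / s)"
    using assms by (intro sum_powr_le_powr_sum) auto
  finally have "(\<Sum>j\<in>J. a j) powr s \<le> ((\<Sum>j\<in>J. a j powr s) powr (1 / s)) powr s"
    using assms by (intro powr_mono2 sum_nonneg) auto
  also have "\<dots> = (\<Sum>j\<in>J. a j powr s)"
    using assms by (simp add: powr_powr sum_nonneg)
  finally show ?thesis .
qed

text \<open>Each layer is a nondecreasing function of the value that it truncates. For
  \<open>t \<le> s\<close> the absolute values can therefore be dropped, and the sum
  telescopes.\<close>

lemma sum_abs_layers_le:
  fixes l :: "nat \<Rightarrow> real"
  assumes "incseq l"
  shows "(\<Sum>j<M. \<bar>(min s (l (Suc j)) - min s (l j)) - (min t (l (Suc j)) - min t (l j))\<bar>) \<le> \<bar>s - t\<bar>"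
proof -
  have *: "(\<Sum>j<M. \<bar>(min s (l (Suc j)) - min s (l j)) - (min t (l (Suc j)) - min t (l j))\<bar>) \<le> s - t"
    if "t \<le> s" for s t
  proof -
    have "(\<Sum>j<M. \<bar>(min s (l (Suc j)) - min s (l j)) - (min t (l (Suc j)) - min t (l j))\<bar>)
        = (\<Sum>j<M. (min s (l (Suc j)) - min t (l (Suc j))) - (min s (l j) - min t (l j)))"
    proof (intro sum.cong refl)
      fix j
      have "l j \<le> l (Suc j)" using assms by (simp add: incseq_SucD)
      then show "\<bar>(min s (l (Suc j)) - min s (l j)) - (min t (l (Suc j)) - min t (l j))\<bar>
        = (min s (l (Suc j)) - min t (l (Suc j))) - (min s (l j) - min t (l j))"
        using that by (auto simp: min_def)
    qed
    also have "\<dots> = (min s (l M) - min t (l M)) - (min s (l 0) - min t (l 0))"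
      by (subst sum_lessThan_telescope) simp
    also have "\<dots> \<le> s - t" using that by (auto simp: min_def)
    finally show ?thesis .
  qed
  show ?thesis
  proof (cases "t \<le> s")
    case False
    then show ?thesis using *[of s t] by (simp add: abs_minus_commute)
  qed (use *[of t s] in simp)
qed

text \<open>Moves the power to the finite side, so that monotone convergence can work on the bare
  integral.\<close>

lemma ennpow_le_iff:
  assumes "0 < s" "0 \<le> m"
  shows "ennpow x s \<le> ennreal m \<longleftrightarrow> x \<le> ennreal (m powr (1 / s))"
proof (cases x)
  case (real r)
  have "r powr s \<le> m \<longleftrightarrow> r \<le> m powr (1 / s)"
  proof
    assume "r powr s \<le> m"
    then have "(r powr s) powr (1/s) \<le> m powr (1/s)" using assms by (intro powr_mono2) auto
    then show "r \<le> m powr (1 / s)" using assms real by (simp add: powr_powr)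
  next
    assume "r \<le> m powr (1/s)"
    then have "r powr s \<le> (m powr (1/s)) powr s" using assms real by (intro powr_mono2) auto
    then show "r powr s \<le> m" using assms by (simp add: powr_powr)
  qed
  then show ?thesis using real assms by (simp add: ennpow_def)
qed (simp add: ennpow_def top_unique)

section \<open>Approximating open sets by admissible sets\<close>

text \<open>Vitali's theorem gives countably many disjoint closed balls inside \<open>E\<close> that
  cover it up to a null set; the initial segments of an enumeration give the increasing finite
  unions. Passing to open balls loses only countably many spheres, which are null.\<close>

lemma open_exhausted_by_balls:
  fixes E \<Omega> :: "(real^'n::finite) set"
  assumes "open E" "open \<Omega>" "E \<subseteq> \<Omega>"
  obtains A where "incseq A" "\<And>k. admissible \<Omega> (A k)" "\<And>k::nat. A k \<subseteq> E" "negligible (E - (\<Union>k. A k))"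
proof -
  define K where "K = {(c, r). 0 < r \<and> cball c r \<subseteq> E}"
  have cover: "\<exists>i. i \<in> K \<and> x \<in> cball (fst i) (snd i) \<and> snd i < d" if x: "x \<in> E" "0 < d" for x d
  proof -
    obtain e where e: "e > 0" "cball x e \<subseteq> E" using \<open>open E\<close> x open_contains_cball by blast
    \<comment> \<open>The covering theorem asks for a radius strictly below \<open>d\<close>, hence
      the half.\<close>
    then have "cball x (min e (d/2)) \<subseteq> E" by auto
    then have "(x, min e (d/2)) \<in> K" using e x by (auto simp: K_def)
    then show ?thesis using e x by (intro exI[of _ "(x, min e (d/2))"]) auto
  qed
  obtain C where C: "countable C" "C \<subseteq> K"
     "pairwise (\<lambda>i j. disjnt (cball (fst i) (snd i)) (cball (fst j) (snd j))) C"
     "negligible(E - (\<Union>i \<in> C. cball (fst i) (snd i)))"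
  proof (rule Vitali_covering_theorem_cballs[of K snd E fst])
    show "0 < snd i" if "i \<in> K" for i using that by (auto simp: K_def)
  qed (use cover in blast)+
  define J where "J k = C \<inter> {i. to_nat_on C i < k}" for k
  define A where "A k = (\<Union>i\<in>J k. ball (fst i) (snd i))" for k
  have fin: "finite (J k)" for k
  proof -
    have "inj_on (to_nat_on C) (J k)" using C(1) inj_on_subset[OF inj_on_to_nat_on] by (force simp: J_def)
    moreover have "to_nat_on C ` J k \<subseteq> {..<k}" by (auto simp: J_def)
    ultimately show ?thesis using inj_on_finite by blast
  qed
  have UJ: "(\<Union>k. J k) = C" by (auto simp: J_def)
  show thesis
  proof (rule that[of A])
    show "incseq A" unfolding incseq_def A_def J_def by fastforce
    show "admissible \<Omega> (A k)" for k
      unfolding A_def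
    proof (rule admissible_disjoint_balls)
      show "pairwise (\<lambda>i j. disjnt (cball (fst i) (snd i)) (cball (fst j) (snd j))) (J k)"
        using C(3) by (rule pairwise_subset) (auto simp: J_def)
      fix i assume "i \<in> J k"
      then have "i \<in> K" using C(2) by (auto simp: J_def)
      then have "0 < snd i" "cball (fst i) (snd i) \<subseteq> E" by (auto simp: K_def)
      then show "0 < snd i" "ball (fst i) (snd i) \<subseteq> \<Omega>"
        using \<open>E \<subseteq> \<Omega>\<close> ball_subset_cball by blast+
    qed (use fin \<open>open \<Omega>\<close> in auto)
    show "A k \<subseteq> E" for k
    proof -
      have "cball (fst i) (snd i) \<subseteq> E" if "i \<in> J k" for i
      proof -
        have "i \<in> K" using that C(2) by (auto simp: J_def)
        then show ?thesis by (auto simp: K_def)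
      qed
      then show ?thesis using ball_subset_cball unfolding A_def by blast
    qed
    have "E - (\<Union>k. A k) \<subseteq> (E - (\<Union>i \<in> C. cball (fst i) (snd i))) \<union> (\<Union>i\<in>C. sphere (fst i) (snd i))"
      using UJ unfolding A_def by (force simp: less_le)
    moreover have "negligible (\<Union>i\<in>C. sphere (fst i) (snd i))"
      using C(1) by (intro negligible_countable_Union) (auto simp: negligible_sphere)
    ultimately show "negligible (E - (\<Union>k. A k))"
      using C(4) negligible_Un negligible_subset by blast
  qed
qed

text \<open>Extends a bound from admissible sets to open ones: monotone convergence along the
  exhaustion, whose missing part is null.\<close>

lemma ennpow_set_nn_integral_le:
  fixes E \<Omega> :: "(real^'n::finite) set" and f :: "real^'n \<Rightarrow> ennreal"
  assumes "open E" "open \<Omega>" "E \<subseteq> \<Omega>" "0 < s"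
    and meas: "(\<lambda>x. f x * indicator E x) \<in> borel_measurable lebesgue"
    and bd: "\<And>A. admissible \<Omega> A \<Longrightarrow> A \<subseteq> E \<Longrightarrow> ennpow (\<integral>\<^sup>+ x \<in> A. f x \<partial>lebesgue) s \<le> m"
  shows "ennpow (\<integral>\<^sup>+ x \<in> E. f x \<partial>lebesgue) s \<le> m"
proof (cases m)
  case (real m')
  obtain A where A: "incseq A" "\<And>k. admissible \<Omega> (A k)" "\<And>k::nat. A k \<subseteq> E" "negligible (E - (\<Union>k. A k))"
    using open_exhausted_by_balls[OF assms(1-3)] by blast
  have "AE x in lebesgue. x \<notin> E - (\<Union>k. A k)"
    using A(4) unfolding negligible_iff_null_sets by (rule AE_not_in)
  then have "(\<integral>\<^sup>+ x \<in> E. f x \<partial>lebesgue) = (\<integral>\<^sup>+ x. (SUP k. f x * indicator (A k) x) \<partial>lebesgue)"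
  proof (intro nn_integral_cong_AE, eventually_elim)
    case (elim x)
    show ?case
    proof (rule antisym)
      show "f x * indicator E x \<le> (SUP k. f x * indicator (A k) x)"
      proof (cases "x \<in> E")
        case True
        then obtain k where "x \<in> A k" using elim by blast
        then have "f x * indicator E x = f x * indicator (A k) x" using True by simp
        also have "\<dots> \<le> (SUP k. f x * indicator (A k) x)" by (rule SUP_upper) simp
        finally show ?thesis .
      qed simp
      show "(SUP k. f x * indicator (A k) x) \<le> f x * indicator E x"
        using A(3) by (intro SUP_least mult_left_mono) (auto split: split_indicator)
    qed
  qed
  also have "\<dots> = (SUP k. \<integral>\<^sup>+ x. f x * indicator (A k) x \<partial>lebesgue)"
  proof (rule nn_integral_monotone_convergence_SUP)
    show "incseq (\<lambda>k x. f x * indicator (A k) x)"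
      using A(1) by (auto simp: incseq_def le_fun_def intro!: mult_left_mono split: split_indicator)
    fix k
    have "open (A k)" using A(2) by (auto simp: admissible_def)
    then have "A k \<in> sets lebesgue" by (simp add: lmeasurable_open sets_completionI_sets)
    \<comment> \<open>Measurability is available only for \<open>f\<close> cut off to
      \<open>E\<close>, so the cut-off to \<open>A k\<close> is factored through it.\<close>
    moreover have "(\<lambda>x. f x * indicator (A k) x) = (\<lambda>x. (f x * indicator E x) * indicator (A k) x)"
      using A(3)[of k] by (intro ext) (auto split: split_indicator)
    ultimately show "(\<lambda>x. f x * indicator (A k) x) \<in> borel_measurable lebesgue"
      using meas by simp
  qed
  also have "\<dots> \<le> ennreal (m' powr (1 / s))"
    using bd[OF A(2,3)] real \<open>0 < s\<close> by (intro SUP_least) (simp add: ennpow_le_iff)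
  finally show ?thesis using real \<open>0 < s\<close> by (simp add: ennpow_le_iff)
qed simp

section \<open>Summing over the layers\<close>

text \<open>The pointwise bound on differences survives division by the kernel, and superadditivity
  carries it through both integrals. It is needed only on \<open>\<Omega>\<close>, which contains
  every \<open>nbhd_region\<close>.\<close>

lemma energy_sum_le:
  fixes u :: "real^'n::finite \<Rightarrow> real"
  assumes "finite J" "\<And>j. j \<in> J \<Longrightarrow> 0 \<le> c j"
    and le: "\<And>x y. x \<in> \<Omega> \<Longrightarrow> y \<in> \<Omega> \<Longrightarrow> (\<Sum>j\<in>J. c j * \<bar>w j x - w j y\<bar> powr p) \<le> \<bar>u x - u y\<bar> powr p"
  shows "(\<Sum>j\<in>J. ennreal (c j) * (\<integral>\<^sup>+ x \<in> \<Omega>. gu \<Omega> p \<delta> \<tau> (w j) x * G x \<partial>lebesgue))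
     \<le> (\<integral>\<^sup>+ x \<in> \<Omega>. gu \<Omega> p \<delta> \<tau> u x * G x \<partial>lebesgue)"
proof -
  let ?N = "\<lambda>x y :: real^'n. norm (x - y) powr (real CARD('n) + p * \<delta>)"
  have gu: "(\<Sum>j\<in>J. ennreal (c j) * gu \<Omega> p \<delta> \<tau> (w j) x) \<le> gu \<Omega> p \<delta> \<tau> u x" if "x \<in> \<Omega>" for x
  proof -
    have "(\<Sum>j\<in>J. ennreal (c j) * gu \<Omega> p \<delta> \<tau> (w j) x)
      \<le> (\<integral>\<^sup>+ y. (\<Sum>j\<in>J. ennreal (c j) * (ennreal (\<bar>w j x - w j y\<bar> powr p / ?N x y) * indicator (nbhd_region \<Omega> \<tau> x) y)) \<partial>lebesgue)"
      unfolding gu_def using \<open>finite J\<close> by (rule nn_integral_sum_cmult_ge)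
    also have "\<dots> \<le> gu \<Omega> p \<delta> \<tau> u x"
      unfolding gu_def
    proof (rule nn_integral_mono)
      fix y
      show "(\<Sum>j\<in>J. ennreal (c j) * (ennreal (\<bar>w j x - w j y\<bar> powr p / ?N x y) * indicator (nbhd_region \<Omega> \<tau> x) y))
        \<le> ennreal (\<bar>u x - u y\<bar> powr p / ?N x y) * indicator (nbhd_region \<Omega> \<tau> x) y"
      proof (cases "y \<in> nbhd_region \<Omega> \<tau> x")
        case True
        then have "y \<in> \<Omega>" by (simp add: nbhd_region_def)
        have "(\<Sum>j\<in>J. ennreal (c j) * ennreal (\<bar>w j x - w j y\<bar> powr p / ?N x y))
            = ennreal (\<Sum>j\<in>J. c j * (\<bar>w j x - w j y\<bar> powr p / ?N x y))"
          using assms(2) by (simp add: sum_ennreal flip: ennreal_mult)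
        also have "\<dots> = ennreal ((\<Sum>j\<in>J. c j * \<bar>w j x - w j y\<bar> powr p) / ?N x y)"
          by (simp add: sum_divide_distrib)
        \<comment> \<open>For \<open>y = x\<close> the denominator is 0, and both quotients are 0 by
          convention.\<close>
        also have "\<dots> \<le> ennreal (\<bar>u x - u y\<bar> powr p / ?N x y)"
          using le[OF \<open>x \<in> \<Omega>\<close> \<open>y \<in> \<Omega>\<close>] by (intro ennreal_leI divide_right_mono) auto
        finally show ?thesis using True by simp
      qed simp
    qed
    finally show ?thesis .
  qed
  have "(\<Sum>j\<in>J. ennreal (c j) * (\<integral>\<^sup>+ x \<in> \<Omega>. gu \<Omega> p \<delta> \<tau> (w j) x * G x \<partial>lebesgue))
     \<le> (\<integral>\<^sup>+ x. (\<Sum>j\<in>J. ennreal (c j) * (gu \<Omega> p \<delta> \<tau> (w j) x * G x * indicator \<Omega> x)) \<partial>lebesgue)"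
    using \<open>finite J\<close> by (rule nn_integral_sum_cmult_ge)
  also have "\<dots> = (\<integral>\<^sup>+ x \<in> \<Omega>. (\<Sum>j\<in>J. ennreal (c j) * gu \<Omega> p \<delta> \<tau> (w j) x) * G x \<partial>lebesgue)"
    by (simp add: sum_distrib_right mult.assoc)
  also have "\<dots> \<le> (\<integral>\<^sup>+ x \<in> \<Omega>. gu \<Omega> p \<delta> \<tau> u x * G x \<partial>lebesgue)"
    using gu by (intro nn_integral_mono) (auto intro: mult_right_mono split: split_indicator)
  finally show ?thesis .
qed

text \<open>The exponent \<open>p / q\<close> is at most 1, so raising the sum to it is subadditive.
  Each term becomes \<open>4 powr p * l j powr p * F j powr (p / q)\<close>, where
  \<open>cap\<close> applies and leaves the weighted sum of the \<open>e j\<close>.\<close>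

lemma level_sum_bound:
  fixes F e l :: "'i \<Rightarrow> real"
  assumes "finite J" "1 \<le> p" "p \<le> q" "0 \<le> C"
    and nonneg: "\<And>j. j \<in> J \<Longrightarrow> 0 \<le> F j" "\<And>j. j \<in> J \<Longrightarrow> 0 \<le> l j"
    and cap: "\<And>j. j \<in> J \<Longrightarrow> F j powr (p / q) \<le> C * e j"
    and sum: "(\<Sum>j\<in>J. l j powr p * e j) \<le> I"
  shows "(\<Sum>j\<in>J. (4 * l j) powr q * F j) \<le> (C * 4 powr p * I) powr (q / p)"
proof -
  let ?S = "\<Sum>j\<in>J. (4 * l j) powr q * F j"
  have S: "0 \<le> ?S" using nonneg by (intro sum_nonneg) auto
  have "?S powr (p / q) \<le> (\<Sum>j\<in>J. ((4 * l j) powr q * F j) powr (p / q))"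
    using assms by (intro powr_sum_le_sum_powr) auto
  also have "\<dots> = (\<Sum>j\<in>J. 4 powr p * l j powr p * F j powr (p / q))"
    using assms by (intro sum.cong) (auto simp: powr_mult powr_powr)
  also have "\<dots> \<le> (\<Sum>j\<in>J. 4 powr p * l j powr p * (C * e j))"
    using cap by (intro sum_mono mult_left_mono) auto
  also have "\<dots> = C * 4 powr p * (\<Sum>j\<in>J. l j powr p * e j)"
    by (simp add: sum_distrib_left mult_ac)
  also have "\<dots> \<le> C * 4 powr p * I"
    using sum \<open>0 \<le> C\<close> by (intro mult_left_mono) auto
  finally have "(?S powr (p / q)) powr (q / p) \<le> (C * 4 powr p * I) powr (q / p)"
    using assms by (intro powr_mono2) auto
  then show ?thesis using assms S by (simp add: powr_powr)
qed

lemma borel_measurable_cont_times_indicator: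
  fixes h :: "'a::euclidean_space \<Rightarrow> real"
  assumes "S \<in> sets borel" "continuous_on S h"
  shows "(\<lambda>x. ennreal (h x) * indicator S x) \<in> borel_measurable lebesgue"
proof -
  have "(\<lambda>x. ennreal (indicator S x *\<^sub>R h x)) \<in> borel_measurable borel"
    using borel_measurable_continuous_on_indicator[OF assms] by simp
  moreover have "(\<lambda>x. ennreal (indicator S x *\<^sub>R h x)) = (\<lambda>x. ennreal (h x) * indicator S x)"
    by (auto split: split_indicator)
  ultimately show ?thesis by (simp add: measurable_completion)
qed

text \<open>One term suffices: if \<open>l (Suc k) < v\<close> and
  \<open>v \<le> l (Suc (Suc k))\<close>, then \<open>v \<le> 4 * l k\<close>, and the other terms
  are nonnegative. This is the origin of the factor 4.\<close>

lemma powr_le_layer_sum: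
  fixes l :: "nat \<Rightarrow> real"
  assumes l: "\<And>j. l (Suc j) = 2 * l j" "0 < l 0" and "0 < q" "l 1 < v" "v \<le> l (Suc M)"
  shows "v powr q \<le> (\<Sum>j<M. (4 * l j) powr q * (if l (Suc j) < v then 1 else 0))"
  using assms(5)
proof (induction M)
  case 0
  then show ?case using assms by simp
next
  case (Suc M)
  show ?case
  proof (cases "v \<le> l (Suc M)")
    case True
    have "0 \<le> (4 * l M) powr q * (if l (Suc M) < v then 1 else 0)" by simp
    then show ?thesis using Suc.IH[OF True] unfolding sum.lessThan_Suc by linarith
  next
    case False
    have "0 \<le> (\<Sum>j<M. (4 * l j) powr q * (if l (Suc j) < v then 1 else 0))"
      by (intro sum_nonneg) simp
    moreover have "v powr q \<le> (4 * l M) powr q"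
      using assms False Suc.prems l(1)[of M] l(1)[of "Suc M"] by (intro powr_mono2) auto
    ultimately show ?thesis using False by simp
  qed
qed

section \<open>From the capacity condition to the integral inequality\<close>

theorem theorem3p1:
  fixes \<Omega> :: "(real^'n) set" and f g :: "real^'n \<Rightarrow> real"
    and p q \<delta> \<tau> :: real
  assumes n2: "CARD('n) \<ge> 2"
    and \<Omega>_open: "open \<Omega>"
    and f_cont: "continuous_on \<Omega> f" and f_pos: "\<forall>x\<in>\<Omega>. f x > 0"
    and g_cont: "continuous_on \<Omega> g" and g_pos: "\<forall>x\<in>\<Omega>. g x > 0"
    and f_int: "(\<integral>\<^sup>+ x \<in> \<Omega>. ennreal (f x) \<partial>lebesgue) < \<infinity>"
    and pq: "1 \<le> p" "p \<le> q"
    and \<delta>: "0 < \<delta>" "\<delta> < 1"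
    and \<tau>: "0 < \<tau>"
    and hyp: "\<forall>c r. 0 < r \<and> compactly_in (ball c r) \<Omega> \<longrightarrow>
       (\<exists>C. \<forall>A. admissible \<Omega> A \<and> A \<inter> ball c r = {} \<longrightarrow>
          ennpow (\<integral>\<^sup>+ x \<in> A. ennreal (f x) \<partial>lebesgue) (p / q)
            \<le> ennreal C * (INF u \<in> {u. continuous_on \<Omega> u \<and> (\<forall>x\<in>A. u x \<ge> 1) \<and> (\<forall>x\<in>ball c r. u x = 0)}.
                 (\<integral>\<^sup>+ x \<in> \<Omega>. gu \<Omega> p \<delta> \<tau> u x * ennreal (g x) \<partial>lebesgue)))"
  shows "\<forall>c r. 0 < r \<and> compactly_in (ball c r) \<Omega> \<longrightarrow>
       (\<exists>C. \<forall>u. continuous_on \<Omega> u \<and> (\<forall>x\<in>ball c r. u x = 0) \<longrightarrow>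
          ennpow (\<integral>\<^sup>+ x \<in> \<Omega>. ennreal (\<bar>u x\<bar> powr q * f x) \<partial>lebesgue) (1 / q)
            \<le> ennreal C * ennpow (\<integral>\<^sup>+ x \<in> \<Omega>. gu \<Omega> p \<delta> \<tau> u x * ennreal (g x) \<partial>lebesgue) (1 / p))"
proof (intro allI impI)
  fix c :: "real^'n" and r :: real
  assume "0 < r \<and> compactly_in (ball c r) \<Omega>"
  with hyp obtain C0 where C0: "\<And>A. admissible \<Omega> A \<Longrightarrow> A \<inter> ball c r = {} \<Longrightarrow>
          ennpow (\<integral>\<^sup>+ x \<in> A. ennreal (f x) \<partial>lebesgue) (p / q)
            \<le> ennreal C0 * (INF u \<in> {u. continuous_on \<Omega> u \<and> (\<forall>x\<in>A. u x \<ge> 1) \<and> (\<forall>x\<in>ball c r. u x = 0)}.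
                 (\<integral>\<^sup>+ x \<in> \<Omega>. gu \<Omega> p \<delta> \<tau> u x * ennreal (g x) \<partial>lebesgue))" by blast
  \<comment> \<open>\<open>C0\<close> may be zero or negative, in which case
    \<open>ennreal C0 = 0\<close>. A positive constant permits real arithmetic and keeps the
    right-hand side infinite when the energy is.\<close>
  define C where "C = max C0 1"
  have C: "1 \<le> C" "C0 \<le> C" by (auto simp: C_def)
  have q1: "1 \<le> q" using pq by simp
  let ?E = "\<lambda>u. \<integral>\<^sup>+ x \<in> \<Omega>. gu \<Omega> p \<delta> \<tau> u x * ennreal (g x) \<partial>lebesgue"
  \<comment> \<open>The hypothesis for open \<open>E\<close> that need not be admissible: a test
    function for \<open>E\<close> is one for every admissible \<open>A \<subseteq> E\<close>, and
    such sets exhaust \<open>E\<close> up to a null set.\<close>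
  have cap: "ennpow (\<integral>\<^sup>+ x \<in> E. ennreal (f x) \<partial>lebesgue) (p / q) \<le> ennreal C * ?E w"
    if E: "open E" "E \<subseteq> \<Omega>" "E \<inter> ball c r = {}"
      and w: "continuous_on \<Omega> w" "\<And>x. x \<in> E \<Longrightarrow> 1 \<le> w x" "\<And>x. x \<in> ball c r \<Longrightarrow> w x = 0" for E w
  proof (rule ennpow_set_nn_integral_le[OF E(1) \<Omega>_open E(2)])
    show "0 < p / q" using pq by simp
    show "(\<lambda>x. ennreal (f x) * indicator E x) \<in> borel_measurable lebesgue"
      using E(1,2) f_cont by (intro borel_measurable_cont_times_indicator) (auto intro: continuous_on_subset)
    fix A assume A: "admissible \<Omega> A" "A \<subseteq> E"
    have "ennpow (\<integral>\<^sup>+ x \<in> A. ennreal (f x) \<partial>lebesgue) (p / q)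
            \<le> ennreal C0 * (INF u \<in> {u. continuous_on \<Omega> u \<and> (\<forall>x\<in>A. u x \<ge> 1) \<and> (\<forall>x\<in>ball c r. u x = 0)}. ?E u)"
      using A E by (intro C0) auto
    also have "\<dots> \<le> ennreal C * ?E w"
      using C w A(2) by (intro mult_mono INF_lower ennreal_leI) auto
    finally show "ennpow (\<integral>\<^sup>+ x \<in> A. ennreal (f x) \<partial>lebesgue) (p / q) \<le> ennreal C * ?E w" .
  qed
  show "\<exists>C. \<forall>u. continuous_on \<Omega> u \<and> (\<forall>x\<in>ball c r. u x = 0) \<longrightarrow>
          ennpow (\<integral>\<^sup>+ x \<in> \<Omega>. ennreal (\<bar>u x\<bar> powr q * f x) \<partial>lebesgue) (1 / q)
            \<le> ennreal C * ennpow (?E u) (1 / p)"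
  \<comment> \<open>The 4 bounds \<open>\<bar>u x\<bar>\<close> by \<open>4 * l j\<close> between
    the levels \<open>j + 1\<close> and \<open>j + 2\<close>; the root of \<open>C\<close> comes
    from taking the power \<open>1 / p\<close> of \<open>C\<close> times the energy.\<close>
  proof (intro exI[of _ "4 * C powr (1 / p)"] allI impI)
    fix u :: "real^'n \<Rightarrow> real"
    assume u: "continuous_on \<Omega> u \<and> (\<forall>x\<in>ball c r. u x = 0)"
    show "ennpow (\<integral>\<^sup>+ x \<in> \<Omega>. ennreal (\<bar>u x\<bar> powr q * f x) \<partial>lebesgue) (1 / q)
            \<le> ennreal (4 * C powr (1 / p)) * ennpow (?E u) (1 / p)"
    proof (cases "?E u")
      case top
      have "ennreal (4 * C powr (1 / p)) \<noteq> 0" using C by simp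
      then show ?thesis using top by (simp add: ennpow_def ennreal_mult_top)
    next
      case (real I)
      let ?K = "(C * 4 powr p * I) powr (q / p)"
      \<comment> \<open>The levels are \<open>2 powr (j - N)\<close>, shifted to start at index 0.
        With \<open>2 * N\<close> layers, \<open>h N\<close> sees the values from
        \<open>2 / 2 ^ N\<close> to \<open>2 * 2 ^ N\<close>, and these ranges exhaust the positive
        reals.\<close>
      define l :: "nat \<Rightarrow> nat \<Rightarrow> real" where "l N j = 2 ^ j / 2 ^ N" for N j
      define h where "h N x = ennreal (\<bar>u x\<bar> powr q * f x) *
        indicator {x \<in> \<Omega>. l N 1 < \<bar>u x\<bar> \<and> \<bar>u x\<bar> \<le> l N (Suc (2 * N))} x" for N x
      have l: "0 < l N j" "l N (Suc j) = 2 * l N j" for N j by (auto simp: l_def)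
      have contu: "continuous_on \<Omega> (\<lambda>x. \<bar>u x\<bar>)" using u by (auto intro: continuous_intros)
      have level_open: "open {x \<in> \<Omega>. a < \<bar>u x\<bar>}" for a
      proof -
        have "{x \<in> \<Omega>. a < \<bar>u x\<bar>} = \<Omega> \<inter> (\<lambda>x. \<bar>u x\<bar>) -` {a<..}" by auto
        then show ?thesis using continuous_open_preimage[OF contu \<Omega>_open] by simp
      qed
      have "{x \<in> \<Omega>. a < \<bar>u x\<bar> \<and> \<bar>u x\<bar> \<le> b} = {x \<in> \<Omega>. a < \<bar>u x\<bar>} - {x \<in> \<Omega>. b < \<bar>u x\<bar>}" for a b
        by auto
      then have level_borel: "{x \<in> \<Omega>. a < \<bar>u x\<bar> \<and> \<bar>u x\<bar> \<le> b} \<in> sets borel" for a b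
        by (simp add: level_open sets.Diff borel_open)
      have contq: "continuous_on \<Omega> (\<lambda>x. \<bar>u x\<bar> powr q * f x)"
        using contu f_cont q1 by (intro continuous_on_mult continuous_on_powr' continuous_on_const) auto
      have h_meas: "h N \<in> borel_measurable lebesgue" for N
        unfolding h_def using level_borel contq
        by (intro borel_measurable_cont_times_indicator) (auto intro: continuous_on_subset)
      have h_bound: "(\<integral>\<^sup>+ x. h N x \<partial>lebesgue) \<le> ennreal ?K" for N
      proof -
        define E where "E j = {x \<in> \<Omega>. l N (Suc j) < \<bar>u x\<bar>}" for j
        define w where "w j x = (min \<bar>u x\<bar> (l N (Suc j)) - min \<bar>u x\<bar> (l N j)) / l N j" for j x
        \<comment> \<open>\<open>enn2real\<close> would turn an infinite integral into 0; the finite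
          integral of \<open>f\<close> over \<open>\<Omega>\<close> excludes this.\<close>
        define F where "F j = enn2real (\<integral>\<^sup>+ x \<in> E j. ennreal (f x) \<partial>lebesgue)" for j
        have F: "(\<integral>\<^sup>+ x \<in> E j. ennreal (f x) \<partial>lebesgue) = ennreal (F j)" for j
        proof -
          have "(\<integral>\<^sup>+ x \<in> E j. ennreal (f x) \<partial>lebesgue) \<le> (\<integral>\<^sup>+ x \<in> \<Omega>. ennreal (f x) \<partial>lebesgue)"
            by (intro nn_integral_mono) (auto simp: E_def split: split_indicator)
          then show ?thesis using f_int by (simp add: F_def order_le_less_trans)
        qed
        have F0: "0 \<le> F j" for j by (simp add: F_def)
        \<comment> \<open>The factor \<open>l N j\<close> undoes the normalisation of
          \<open>w j\<close>. Superadditivity for the exponent \<open>p \<ge> 1\<close> then reduces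
          the claim to the sum of the unnormalised layers.\<close>
        have w_diff: "(\<Sum>j<2*N. l N j powr p * \<bar>w j x - w j y\<bar> powr p) \<le> \<bar>u x - u y\<bar> powr p" for x y
        proof -
          let ?T = "\<lambda>j s. min s (l N (Suc j)) - min s (l N j)"
          have "(\<Sum>j<2*N. l N j powr p * \<bar>w j x - w j y\<bar> powr p)
            = (\<Sum>j<2*N. \<bar>?T j \<bar>u x\<bar> - ?T j \<bar>u y\<bar>\<bar> powr p)"
          proof (intro sum.cong refl)
            fix j
            have "w j x - w j y = (?T j \<bar>u x\<bar> - ?T j \<bar>u y\<bar>) / l N j"
              by (simp add: w_def diff_divide_distrib)
            then have "l N j * \<bar>w j x - w j y\<bar> = \<bar>?T j \<bar>u x\<bar> - ?T j \<bar>u y\<bar>\<bar>"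
              using l(1)[of N j] by (simp add: abs_divide)
            then show "l N j powr p * \<bar>w j x - w j y\<bar> powr p = \<bar>?T j \<bar>u x\<bar> - ?T j \<bar>u y\<bar>\<bar> powr p"
              using l(1)[of N j] by (metis abs_ge_zero less_imp_le powr_mult)
          qed
          also have "\<dots> \<le> (\<Sum>j<2*N. \<bar>?T j \<bar>u x\<bar> - ?T j \<bar>u y\<bar>\<bar>) powr p"
            using pq by (intro sum_powr_le_powr_sum) auto
          also have "\<dots> \<le> \<bar>u x - u y\<bar> powr p"
          proof (intro powr_mono2)
            have "incseq (l N)" using l[of N] by (intro incseq_SucI) (simp add: less_imp_le)
            then have "(\<Sum>j<2*N. \<bar>?T j \<bar>u x\<bar> - ?T j \<bar>u y\<bar>\<bar>) \<le> \<bar>\<bar>u x\<bar> - \<bar>u y\<bar>\<bar>"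
              by (rule sum_abs_layers_le)
            then show "(\<Sum>j<2*N. \<bar>?T j \<bar>u x\<bar> - ?T j \<bar>u y\<bar>\<bar>) \<le> \<bar>u x - u y\<bar>" by linarith
          qed (use pq in \<open>auto intro: sum_nonneg\<close>)
          finally show ?thesis .
        qed
        have energy: "(\<Sum>j<2*N. ennreal (l N j powr p) * ?E (w j)) \<le> ennreal I"
          unfolding real(2)[symmetric] by (rule energy_sum_le) (use w_diff in auto)
        define e where "e j = enn2real (?E (w j))" for j
        \<comment> \<open>A positive multiple of this energy is one term of a sum bounded by the
          finite \<open>I\<close>, so the conversion to a real loses nothing.\<close>
        have e: "?E (w j) = ennreal (e j)" if "j < 2 * N" for j
        proof -
          have "ennreal (l N j powr p) * ?E (w j) \<le> (\<Sum>j<2*N. ennreal (l N j powr p) * ?E (w j))"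
            using that by (intro member_le_sum) auto
          also note energy
          finally have "ennreal (l N j powr p) * ?E (w j) \<noteq> top"
            by (auto simp: top_unique)
          then have "?E (w j) \<noteq> top" using l(1)[of N j] by (auto simp: ennreal_mult_top)
          then show ?thesis by (simp add: e_def less_top)
        qed
        have e0: "0 \<le> e j" for j by (simp add: e_def)
        have "ennreal (\<Sum>j<2*N. l N j powr p * e j) \<le> ennreal I"
          using energy e e0 by (simp flip: ennreal_mult)
        then have sum_e: "(\<Sum>j<2*N. l N j powr p * e j) \<le> I" using real(1) by simp
        have cap_j: "F j powr (p / q) \<le> C * e j" if "j < 2 * N" for j
        proof -
          have "ennpow (\<integral>\<^sup>+ x \<in> E j. ennreal (f x) \<partial>lebesgue) (p / q) \<le> ennreal C * ?E (w j)"
          proof (rule cap)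
            show "open (E j)" unfolding E_def by (rule level_open)
            show "E j \<subseteq> \<Omega>" by (auto simp: E_def)
            show "E j \<inter> ball c r = {}"
            proof -
              have "\<bar>u x\<bar> = 0" if "x \<in> ball c r" for x using u that by simp
              then show ?thesis using l(1)[of N "Suc j"] unfolding E_def by fastforce
            qed
            show "continuous_on \<Omega> (w j)"
              unfolding w_def using u l(1)[of N j] by (intro continuous_intros) auto
            \<comment> \<open>Above the level \<open>l N (Suc j)\<close> both minima equal their
              levels, and \<open>(2 * l N j - l N j) / l N j = 1\<close>.\<close>
            show "1 \<le> w j x" if "x \<in> E j" for x
              using that l(1)[of N j] unfolding w_def E_def l(2) by (auto simp: min_def)
            show "w j x = 0" if "x \<in> ball c r" for x
              using that u l(1)[of N j] l(1)[of N "Suc j"] by (auto simp: w_def min_def)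
          qed
          then have "ennreal (F j powr (p / q)) \<le> ennreal (C * e j)"
            using C e0[of j] by (simp add: F e[OF that] F0 ennpow_def ennreal_mult)
          then show ?thesis using C e0[of j] by simp
        qed
        have "(\<integral>\<^sup>+ x. h N x \<partial>lebesgue)
          \<le> (\<integral>\<^sup>+ x. (\<Sum>j<2*N. ennreal ((4 * l N j) powr q) * (ennreal (f x) * indicator (E j) x)) \<partial>lebesgue)"
        proof (intro nn_integral_mono)
          fix x
          show "h N x \<le> (\<Sum>j<2*N. ennreal ((4 * l N j) powr q) * (ennreal (f x) * indicator (E j) x))"
          proof (cases "x \<in> \<Omega> \<and> l N 1 < \<bar>u x\<bar> \<and> \<bar>u x\<bar> \<le> l N (Suc (2 * N))")
            case True
            then have fx: "0 \<le> f x" using f_pos by (auto intro: less_imp_le)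
            have "\<bar>u x\<bar> powr q * f x
              \<le> (\<Sum>j<2*N. (4 * l N j) powr q * (if l N (Suc j) < \<bar>u x\<bar> then 1 else 0)) * f x"
              using True q1 l fx by (intro mult_right_mono powr_le_layer_sum) auto
            then have "h N x \<le> ennreal (\<Sum>j<2*N. (4 * l N j) powr q * (f x * indicator (E j) x))"
              using True unfolding h_def sum_distrib_right E_def
              by (auto intro!: ennreal_leI simp: indicator_def mult_ac of_bool_def cong: if_cong)
            also have "\<dots> = (\<Sum>j<2*N. ennreal ((4 * l N j) powr q) * (ennreal (f x) * indicator (E j) x))"
              using fx by (simp add: ennreal_mult ennreal_indicator flip: sum_ennreal)
            finally show ?thesis .
          qed (auto simp: h_def)
        qed
        also have "\<dots> = (\<Sum>j<2*N. ennreal ((4 * l N j) powr q) * ennreal (F j))"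
        proof -
          have "(\<lambda>x. ennreal (f x) * indicator (E j) x) \<in> borel_measurable lebesgue" for j
            using level_open f_cont unfolding E_def
            by (intro borel_measurable_cont_times_indicator) (auto intro: continuous_on_subset)
          then show ?thesis by (simp add: nn_integral_sum nn_integral_cmult F)
        qed
        also have "\<dots> = ennreal (\<Sum>j<2*N. (4 * l N j) powr q * F j)"
          by (simp add: F0 flip: ennreal_mult)
        also have "\<dots> \<le> ennreal ?K"
          using pq C l(1) cap_j sum_e
          by (intro ennreal_leI level_sum_bound) (auto simp: F0 intro: less_imp_le)
        finally show ?thesis .
      qed
      have "(\<integral>\<^sup>+ x \<in> \<Omega>. ennreal (\<bar>u x\<bar> powr q * f x) \<partial>lebesgue) = (\<integral>\<^sup>+ x. (SUP N. h N x) \<partial>lebesgue)"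
      proof (intro nn_integral_cong antisym)
        fix x
        show "(SUP N. h N x) \<le> ennreal (\<bar>u x\<bar> powr q * f x) * indicator \<Omega> x"
          by (intro SUP_least) (auto simp: h_def split: split_indicator)
        show "ennreal (\<bar>u x\<bar> powr q * f x) * indicator \<Omega> x \<le> (SUP N. h N x)"
        \<comment> \<open>Zeros of \<open>u\<close> lie in no range of levels, but there the
          integrand vanishes too because \<open>0 powr q = 0\<close>.\<close>
        proof (cases "x \<in> \<Omega> \<and> u x \<noteq> 0")
          case True
          \<comment> \<open>\<open>N1\<close> brings the lowest level below
            \<open>\<bar>u x\<bar>\<close>, and \<open>N2\<close> lifts the highest above
            it.\<close>
          obtain N1 where N1: "2 / \<bar>u x\<bar> < 2 ^ N1" using real_arch_pow[of 2] by auto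
          obtain N2 where N2: "\<bar>u x\<bar> < 2 ^ N2" using real_arch_pow[of 2] by auto
          define N where "N = max N1 N2"
          have "(2::real) ^ N1 \<le> 2 ^ N" "(2::real) ^ N2 \<le> 2 ^ N" by (auto simp: N_def)
          then have "2 / \<bar>u x\<bar> < 2 ^ N" "\<bar>u x\<bar> < 2 ^ N" using N1 N2 by linarith+
          then have "2 / 2 ^ N < \<bar>u x\<bar>" "\<bar>u x\<bar> \<le> 2 * 2 ^ N"
            using True by (simp_all add: divide_less_eq mult.commute)
          moreover have "l N 1 = 2 / 2 ^ N" "l N (Suc (2 * N)) = 2 * 2 ^ N"
            unfolding l_def mult_2[of N] by (simp_all add: power_add)
          ultimately have "l N 1 < \<bar>u x\<bar>" "\<bar>u x\<bar> \<le> l N (Suc (2 * N))"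
            by simp_all
          then have "ennreal (\<bar>u x\<bar> powr q * f x) * indicator \<Omega> x = h N x"
            using True by (simp add: h_def)
          also have "\<dots> \<le> (SUP N. h N x)" by (rule SUP_upper) simp
          finally show ?thesis .
        qed (use q1 in \<open>auto split: split_indicator\<close>)
      qed
      also have "\<dots> = (SUP N. \<integral>\<^sup>+ x. h N x \<partial>lebesgue)"
      proof (rule nn_integral_monotone_convergence_SUP[OF _ h_meas])
        have "l (Suc N) 1 \<le> l N 1" "l N (Suc (2 * N)) \<le> l (Suc N) (Suc (2 * Suc N))" for N
          by (auto simp: l_def field_simps)
        then show "incseq h"
          unfolding h_def
          by (intro incseq_SucI le_funI mult_left_mono)
            (auto split: split_indicator intro: order_le_less_trans order_trans)
      qed
      also have "\<dots> \<le> ennreal ?K" by (intro SUP_least h_bound)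
      \<comment> \<open>Written as a power with exponent \<open>q\<close>, so that
        \<open>ennpow_le_iff\<close> for the exponent \<open>1 / q\<close> extracts the
        root.\<close>
      also have "?K = (4 * C powr (1 / p) * I powr (1 / p)) powr q"
        using C pq real by (simp add: powr_mult powr_powr)
      finally have "ennpow (\<integral>\<^sup>+ x \<in> \<Omega>. ennreal (\<bar>u x\<bar> powr q * f x) \<partial>lebesgue) (1 / q)
          \<le> ennreal (4 * C powr (1 / p) * I powr (1 / p))"
        using C q1 by (subst ennpow_le_iff) auto
      also have "\<dots> = ennreal (4 * C powr (1 / p)) * ennpow (?E u) (1 / p)"
        using real by (simp add: ennpow_def flip: ennreal_mult)
      finally show ?thesis .
    qed
  qed
qed

end
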